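(* Let $(W,S)$ be a finite Coxeter system and let $I,J\subset S$. Then $$|X_{IJ}|=\langle 1_{W_I}^W,1_{W_J}^W\rangle_W .$$ Equivalently, the number of $w\in W$ such that the ascent set of $w$ contains $I$ and the ascent set of $w^{-1}$ contains $J$ is equal to $\langle 1_{W_I}^W,1_{W_J}^W\rangle_W$.
   Context: $\ell$ is the length function of $(W,S)$. For $I\subset S$, $W_I$ is the subgroup generated by $I$, $X_I=\{w\in W:\ell(ws)>\ell(w)\ \forall s\in I\}$, and $X_{IJ}=X_I^{-1}\cap X_J$ where $X_I^{-1}=\{x^{-1}: x\in X_I\}$. The ascent set of $w$ is $\{s\in S:\ell(ws)>\ell(w)\}$. $1_{W_I}^W$ is the character of $W$ induced from the trivial character of $W_I$, and $\langle f,g\rangle_W=\frac{1}{|W|}\sum_{w\in W}f(w)g(w)$. *)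

theory Defs
  imports Complex_Main "HOL-Algebra.Generated_Groups" "HOL-Algebra.Multiplicative_Group"
begin

definition word_prod :: "('a, 'b) monoid_scheme \<Rightarrow> 'a list \<Rightarrow> 'a" where
  "word_prod G u = foldr (\<otimes>\<^bsub>G\<^esub>) u \<one>\<^bsub>G\<^esub>"

(* Insertion of the relator (s t)^m(s,t) into a word, where m(s,t) is the order of s t in G.
   For infinite order, ord is 0 and nothing is inserted, so that there is no relation.
   For s = t the relator is s s, provided s is an involution. *)
inductive coxeter_step :: "('a, 'b) monoid_scheme \<Rightarrow> 'a set \<Rightarrow> 'a list \<Rightarrow> 'a list \<Rightarrow> bool"
  for G S where
  "\<lbrakk>u \<in> lists S; v \<in> lists S; s \<in> S; t \<in> S\<rbrakk> \<Longrightarrow>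
   coxeter_step G S (u @ v) (u @ concat (replicate (group.ord G (s \<otimes>\<^bsub>G\<^esub> t)) [s, t]) @ v)"

(* Bourbaki's definition: G is generated by the set S of elements of order 2 and is presented by
   the relations (s t)^m(s,t) = 1. Since s s = 1 is among the relations, formal inverses of
   generators are not needed: positive words modulo the congruence generated by the relators
   form the presented group, and "presentation" says that it maps isomorphically to G. *)
locale coxeter_system = group G for G :: "('a, 'b) monoid_scheme" (structure) +
  fixes S :: "'a set"
  assumes generators_closed: "S \<subseteq> carrier G"
    and generate_generators: "generate G S = carrier G"
    and ord_generator: "s \<in> S \<Longrightarrow> ord s = 2"
    and presentation: "\<lbrakk>u \<in> lists S; v \<in> lists S\<rbrakk> \<Longrightarrow>
          word_prod G u = word_prod G v \<longleftrightarrow> equivclp (coxeter_step G S) u v"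

definition cox_length :: "('a, 'b) monoid_scheme \<Rightarrow> 'a set \<Rightarrow> 'a \<Rightarrow> nat" where
  "cox_length G S w = (LEAST n. \<exists>u \<in> lists S. length u = n \<and> word_prod G u = w)"

definition ascent_set :: "('a, 'b) monoid_scheme \<Rightarrow> 'a set \<Rightarrow> 'a \<Rightarrow> 'a set" where
  "ascent_set G S w = {s \<in> S. cox_length G S (w \<otimes>\<^bsub>G\<^esub> s) > cox_length G S w}"

definition X_set :: "('a, 'b) monoid_scheme \<Rightarrow> 'a set \<Rightarrow> 'a set \<Rightarrow> 'a set" where
  "X_set G S I =
     {w \<in> carrier G. \<forall>s\<in>I. cox_length G S (w \<otimes>\<^bsub>G\<^esub> s) > cox_length G S w}"

definition X_double :: "('a, 'b) monoid_scheme \<Rightarrow> 'a set \<Rightarrow> 'a set \<Rightarrow> 'a set \<Rightarrow> 'a set" where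
  "X_double G S I J = (set_inv\<^bsub>G\<^esub> (X_set G S I)) \<inter> X_set G S J"

definition trivial_char :: "'a \<Rightarrow> complex" where
  "trivial_char h = 1"

(* The induced class function (1/|H|) * (sum over x in G of chi(x^-1 g x)), where chi is extended
   by 0 outside H. Meaningful for finite G, a subgroup H, a class function chi on H, and g in G. *)
definition induced_char ::
    "('a, 'b) monoid_scheme \<Rightarrow> 'a set \<Rightarrow> ('a \<Rightarrow> complex) \<Rightarrow> 'a \<Rightarrow> complex" where
  "induced_char G H chi g =
     (\<Sum>x\<in>carrier G.
        if inv\<^bsub>G\<^esub> x \<otimes>\<^bsub>G\<^esub> g \<otimes>\<^bsub>G\<^esub> x \<in> H
        then chi (inv\<^bsub>G\<^esub> x \<otimes>\<^bsub>G\<^esub> g \<otimes>\<^bsub>G\<^esub> x) else 0) / of_nat (card H)"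

(* Bilinear, without complex conjugation. *)
definition char_inner ::
    "('a, 'b) monoid_scheme \<Rightarrow> ('a \<Rightarrow> complex) \<Rightarrow> ('a \<Rightarrow> complex) \<Rightarrow> complex" where
  "char_inner G f g = (\<Sum>w\<in>carrier G. f w * g w) / of_nat (card (carrier G))"

end

theory Submission
  imports Defs "HOL-Library.Sublist"
begin

text \<open>
  Both sides count the double cosets of $W_I$ and $W_J$ in $W$.

  For the inner product this is pure group theory. The value of the induced character
  $1_H^G$ at $w$ is $|H|^{-1}$ times the number of $x$ with $x^{-1} w x \in H$, so the inner product
  of $1_H^G$ and $1_K^G$ counts triples $(w, x, y)$ with $x^{-1} w x \in H$ and $y^{-1} w y \in K$.
  Only $z = x^{-1} y$ and $h = x^{-1} w x$ matter, and the pairs $(z, h)$ with $h \in H$ and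
  $z^{-1} h z \in K$ are as many as the elements of $X \times H \times K$, for any set $X$ of
  representatives of the double cosets: the $h$ that belong to $z$ parametrize the ways of writing
  $z = a x b$ (\<open>char_inner_permutation_chars\<close>).

  For $X_{IJ}$ the Coxeter relations enter through the deletion condition: a word that is not
  reduced has a proper subword with the same product (\<open>deletion\<close>). Let $w$ be an element
  of minimal length in a double coset $D$. It lies in $X_{IJ}$, since multiplication by a generator
  always changes the length. Conversely, let $x = a w b$ be any element of $X_{IJ} \cap D$. Delete
  letters from the concatenation of words for $a$, $w$ and $b$ until a reduced word for $x$ is left.
  It has no letter from $a$, because a first letter in $I$ would make $x$ shorter by multiplication
  from the left, and likewise no letter from $b$. What is left is a subword of the word for $w$, and
  by minimality it is the whole word. Hence $x = w$, and $X_{IJ}$ is a set of representatives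
  (\<open>ex1_X_double\<close>).

  The deletion condition comes out of the presentation by counting reflections. A word
  $s_1 \dots s_k$ crosses the reflections $t_i = s_1 \dots s_{i-1} s_i s_{i-1} \dots s_1$. How often a
  given reflection occurs in this list depends modulo 2 only on the product of the word, because
  inserting a relator changes the count by an even number (\<open>even_count_coxeter_step\<close>). If all
  $t_i$ are distinct, every other word for the same element must therefore cross each of them and
  is at least as long. If $t_i = t_j$ with $i < j$, the letters $s_i$ and $s_j$ can be deleted.
\<close>

section \<open>Words and the reflections they cross\<close>

text \<open>
  The entry at position $i$ is the conjugate $s_1 \dots s_{i-1} s_i s_{i-1}^{-1} \dots s_1^{-1}$. For
  words in the generators of a Coxeter group these are the reflections in the walls crossed by the
  gallery that the word describes.
\<close>

fun word_reflections :: "('a, 'b) monoid_scheme \<Rightarrow> 'a list \<Rightarrow> 'a list" where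
  "word_reflections G [] = []"
| "word_reflections G (s # u) =
     s # map (\<lambda>r. s \<otimes>\<^bsub>G\<^esub> r \<otimes>\<^bsub>G\<^esub> inv\<^bsub>G\<^esub> s) (word_reflections G u)"

context group
begin

lemma conj_eq_iff:
  assumes "x \<in> carrier G" "y \<in> carrier G" "r \<in> carrier G"
  shows "x \<otimes> r \<otimes> inv x = y \<longleftrightarrow> r = inv x \<otimes> y \<otimes> x"
  using assms by (metis inv_closed inv_solve_left inv_solve_right m_assoc m_closed)

lemma count_list_map_conj:
  assumes "x \<in> carrier G" "y \<in> carrier G" "set rs \<subseteq> carrier G"
  shows "count_list (map (\<lambda>r. x \<otimes> r \<otimes> inv x) rs) y = count_list rs (inv x \<otimes> y \<otimes> x)"
  using assms by (induction rs) (auto simp: conj_eq_iff)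

lemma inv_cancel_left: "x \<in> carrier G \<Longrightarrow> y \<in> carrier G \<Longrightarrow> inv x \<otimes> (x \<otimes> y) = y"
  and cancel_inv_left: "x \<in> carrier G \<Longrightarrow> y \<in> carrier G \<Longrightarrow> x \<otimes> (inv x \<otimes> y) = y"
  by (simp_all flip: m_assoc)

lemma word_prod_Nil [simp]: "word_prod G [] = \<one>"
  and word_prod_Cons [simp]: "word_prod G (s # u) = s \<otimes> word_prod G u"
  by (simp_all add: word_prod_def)

lemma word_prod_closed [simp]: "set u \<subseteq> carrier G \<Longrightarrow> word_prod G u \<in> carrier G"
  by (induction u) auto

lemma word_prod_append:
  "set u \<subseteq> carrier G \<Longrightarrow> set v \<subseteq> carrier G \<Longrightarrow>
   word_prod G (u @ v) = word_prod G u \<otimes> word_prod G v"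
  by (induction u) (auto simp: m_assoc)

lemma length_word_reflections [simp]: "length (word_reflections G u) = length u"
  by (induction u) auto

lemma word_reflections_closed:
  "set u \<subseteq> carrier G \<Longrightarrow> set (word_reflections G u) \<subseteq> carrier G"
  by (induction u) (auto simp: image_subset_iff subset_iff)

text \<open>
  The reflections of $v$ appear in those of $uv$ conjugated by the product of $u$. This cocycle
  property lets the effect of a relator inserted in the middle of a word be computed from the relator
  alone.
\<close>

lemma count_word_reflections_append:
  assumes "set u \<subseteq> carrier G" "set v \<subseteq> carrier G" "y \<in> carrier G"
  shows "count_list (word_reflections G (u @ v)) y =
           count_list (word_reflections G u) y +
           count_list (word_reflections G v) (inv (word_prod G u) \<otimes> y \<otimes> word_prod G u)"
  using assms
proof (induction u arbitrary: y)
  case Nil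
  then show ?case by simp
next
  case (Cons s u)
  then have s: "s \<in> carrier G" and u: "set u \<subseteq> carrier G" by auto
  let ?y = "inv s \<otimes> y \<otimes> s"
  have "inv (word_prod G u) \<otimes> ?y \<otimes> word_prod G u =
        inv (word_prod G (s # u)) \<otimes> y \<otimes> word_prod G (s # u)"
    using s u Cons.prems by (simp add: inv_mult_group m_assoc)
  moreover have "?y \<in> carrier G" using s Cons.prems by simp
  moreover have "set (word_reflections G (u @ v)) \<subseteq> carrier G"
    using u Cons.prems by (intro word_reflections_closed) auto
  ultimately have "count_list (map (\<lambda>r. s \<otimes> r \<otimes> inv s) (word_reflections G (u @ v))) y =
      count_list (map (\<lambda>r. s \<otimes> r \<otimes> inv s) (word_reflections G u)) y +
      count_list (word_reflections G v)
        (inv (word_prod G (s # u)) \<otimes> y \<otimes> word_prod G (s # u))"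
    using Cons.IH[OF u, of ?y] Cons.prems s word_reflections_closed[OF u]
    by (simp only: count_list_map_conj)
  then show ?case by (cases "s = y") simp_all
qed

end

section \<open>The deletion condition\<close>

context coxeter_system
begin

lemma generator_mem: "s \<in> S \<Longrightarrow> s \<in> carrier G"
  using generators_closed by blast

lemma generator_sq: "s \<in> S \<Longrightarrow> s \<otimes> s = \<one>"
  using pow_ord_eq_1[of s] ord_generator[of s] generator_mem[of s] by (simp add: numeral_2_eq_2)

lemma inv_generator: "s \<in> S \<Longrightarrow> inv s = s"
  using generator_sq generator_mem inv_equality by blast

lemma generator_cancel: "s \<in> S \<Longrightarrow> x \<in> carrier G \<Longrightarrow> s \<otimes> (s \<otimes> x) = x"
  by (simp add: m_assoc[symmetric] generator_mem generator_sq)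

lemma lists_carrier: "u \<in> lists S \<Longrightarrow> set u \<subseteq> carrier G"
  using generators_closed by auto

text \<open>
  With $p = st$ of order $m$, the involutions $s$ and $t$ invert $p$, so that the reflections of an
  alternating word are $s, ps, p^2 s, \dots$; those of the relator $(st)^m$ run twice through one
  period. This gives \<open>even_count_relator\<close> without deciding which of them are distinct, and
  it covers the case $s = t$, where $m = 1$.
\<close>

lemma word_reflections_alternating:
  assumes s: "s \<in> S" and t: "t \<in> S"
  shows "word_reflections G (concat (replicate n [s, t])) =
         map (\<lambda>i. (s \<otimes> t) [^] i \<otimes> s) [0..<2 * n]"
proof (induction n)
  case 0
  then show ?case by simp
next
  case (Suc n)
  let ?p = "s \<otimes> t"
  have c: "s \<in> carrier G" "t \<in> carrier G" using s t generator_mem by auto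
  have shift: "s \<otimes> (t \<otimes> (?p [^] i \<otimes> s) \<otimes> inv t) \<otimes> inv s = ?p [^] Suc (Suc i) \<otimes> s" for i :: nat
  proof -
    have "s \<otimes> (t \<otimes> (?p [^] i \<otimes> s) \<otimes> inv t) \<otimes> inv s = (?p \<otimes> ?p [^] i) \<otimes> (s \<otimes> t \<otimes> s)"
      using c s t by (simp add: m_assoc inv_generator)
    also have "?p \<otimes> ?p [^] i = ?p [^] Suc i"
      using c by (metis m_closed nat_pow_Suc2)
    finally show ?thesis using c by (simp add: m_assoc)
  qed
  have "[0..<2 * Suc n] = 0 # 1 # map (\<lambda>i. Suc (Suc i)) [0..<2 * n]"
    by (simp add: upt_conv_Cons map_Suc_upt flip: map_map[of Suc Suc, unfolded comp_def])
  then show ?case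
    using Suc.IH c s t shift by (simp add: inv_generator m_assoc)
qed

lemma even_count_relator:
  assumes s: "s \<in> S" and t: "t \<in> S"
  shows "even (count_list (word_reflections G (concat (replicate (ord (s \<otimes> t)) [s, t]))) y)"
proof -
  let ?p = "s \<otimes> t" and ?m = "ord (s \<otimes> t)"
  let ?f = "\<lambda>i::nat. ?p [^] i \<otimes> s"
  have c: "?p \<in> carrier G" using s t generator_mem by auto
  have "[0..<2 * ?m] = [0..<?m] @ map (\<lambda>i. i + ?m) [0..<?m]"
    by (simp add: map_add_upt mult_2 upt_add_eq_append[of 0])
  moreover have "?f (i + ?m) = ?f i" for i
    using c by (simp flip: nat_pow_mult)
  ultimately have "map ?f [0..<2 * ?m] = map ?f [0..<?m] @ map ?f [0..<?m]"
    by simp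
  then show ?thesis by (simp add: word_reflections_alternating[OF s t])
qed

lemma word_prod_relator:
  assumes s: "s \<in> S" and t: "t \<in> S"
  shows "word_prod G (concat (replicate (ord (s \<otimes> t)) [s, t])) = \<one>"
proof -
  have c: "s \<in> carrier G" "t \<in> carrier G" using s t generator_mem by auto
  have "word_prod G (concat (replicate n [s, t])) = (s \<otimes> t) [^] n" for n
  proof (induction n)
    case (Suc n)
    have "(s \<otimes> t) [^] Suc n = (s \<otimes> t) \<otimes> (s \<otimes> t) [^] n"
      using c by (metis m_closed nat_pow_Suc2)
    then show ?case using Suc c by (simp add: m_assoc)
  qed simp
  then show ?thesis using c by simp
qed

lemma even_count_coxeter_step:
  assumes "coxeter_step G S u v" "y \<in> carrier G"
  shows "even (count_list (word_reflections G u) y) = even (count_list (word_reflections G v) y)"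
  using assms(1)
proof cases
  case (1 a b s t)
  let ?r = "concat (replicate (ord (s \<otimes> t)) [s, t])"
  have c: "set a \<subseteq> carrier G" "set b \<subseteq> carrier G" "set ?r \<subseteq> carrier G"
    using 1 lists_carrier generator_mem by (auto simp: set_replicate_conv_if split: if_splits)
  have w: "word_prod G ?r = \<one>" using 1 word_prod_relator by simp
  show ?thesis
    using c w assms(2) even_count_relator 1 by (simp add: count_word_reflections_append)
qed

lemma even_count_word_reflections:
  assumes "u \<in> lists S" "v \<in> lists S" "word_prod G u = word_prod G v" "y \<in> carrier G"
  shows "even (count_list (word_reflections G u) y) = even (count_list (word_reflections G v) y)"
proof -
  have "equivclp (coxeter_step G S) u v" using assms presentation by blast
  then show ?thesis
    by (induction rule: equivclp_induct) (use assms(4) even_count_coxeter_step in blast)+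
qed

text \<open>
  Multiplication by $t_i = s_1 \dots s_{i-1} s_i s_{i-1} \dots s_1$ from the left cancels the first
  $i - 1$ letters twice and the letter $s_i$ once.
\<close>

lemma reflection_mult_deletes:
  assumes "u \<in> lists S" "r \<in> set (word_reflections G u)"
  shows "\<exists>v. subseq v u \<and> length v < length u \<and> r \<otimes> word_prod G u = word_prod G v"
  using assms
proof (induction u arbitrary: r)
  case Nil
  then show ?case by simp
next
  case (Cons s u)
  then have s: "s \<in> S" "s \<in> carrier G" and u: "u \<in> lists S" "set u \<subseteq> carrier G"
    using generator_mem lists_carrier by auto
  consider "r = s" | q where "q \<in> set (word_reflections G u)" "r = s \<otimes> q \<otimes> inv s"
    using Cons.prems by auto
  then show ?case
  proof cases
    case 1
    then show ?thesis using s u by (intro exI[of _ u]) (auto simp: generator_cancel)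
  next
    case 2
    obtain v where v: "subseq v u" "length v < length u" "q \<otimes> word_prod G u = word_prod G v"
      using Cons.IH[OF 2(1)] by blast
    have "q \<in> carrier G" using 2 word_reflections_closed u by blast
    then have "r \<otimes> word_prod G (s # u) = word_prod G (s # v)"
      using 2 s u v by (simp add: inv_generator m_assoc generator_cancel flip: v(3))
    then show ?thesis using v by (intro exI[of _ "s # v"]) auto
  qed
qed

text \<open>
  If the first letter $s$ is repeated as $t_j$, undoing the conjugation by $s$ shows that $s$ is also
  among the reflections of the rest $u$ of the word. Then $su$ is $u$ with a letter deleted.
\<close>

lemma repeated_reflection_deletes:
  assumes "u \<in> lists S" "\<not> distinct (word_reflections G u)"
  shows "\<exists>v. subseq v u \<and> length v < length u \<and> word_prod G v = word_prod G u"
  using assms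
proof (induction u)
  case Nil
  then show ?case by simp
next
  case (Cons s u)
  then have s: "s \<in> S" "s \<in> carrier G" and u: "u \<in> lists S" "set u \<subseteq> carrier G"
    using generator_mem lists_carrier by auto
  show ?case
  proof (cases "distinct (word_reflections G u)")
    case False
    then obtain v where "subseq v u" "length v < length u" "word_prod G v = word_prod G u"
      using Cons.IH u by blast
    then show ?thesis by (intro exI[of _ "s # v"]) auto
  next
    case True
    have R: "set (word_reflections G u) \<subseteq> carrier G" using u word_reflections_closed by blast
    have "inj_on (\<lambda>r. s \<otimes> r \<otimes> inv s) (set (word_reflections G u))"
      using R s by (auto simp: inj_on_def subset_iff)
    with True Cons.prems obtain q where q: "q \<in> set (word_reflections G u)" "s = s \<otimes> q \<otimes> inv s"
      by (auto simp: distinct_map)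
    have "q = s"
      using q R s conj_eq_iff[of s s q] by auto
    then obtain v where v: "subseq v u" "length v < length u" "s \<otimes> word_prod G u = word_prod G v"
      using reflection_mult_deletes[OF u(1) q(1)] by auto
    then show ?thesis by (intro exI[of _ v]) auto
  qed
qed

lemma ex_word:
  assumes "I \<subseteq> S" "w \<in> generate G I"
  shows "\<exists>u \<in> lists I. word_prod G u = w"
  using assms(2)
proof induction
  case one
  show ?case by (intro bexI[of _ "[]"]) auto
next
  case (incl h)
  then show ?case using assms(1) generator_mem by (intro bexI[of _ "[h]"]) auto
next
  case (inv h)
  then have "h \<in> S" using assms(1) by blast
  then show ?case using inv inv_generator generator_mem by (intro bexI[of _ "[h]"]) auto
next
  case (eng h k)
  then obtain u v where u: "u \<in> lists I" "word_prod G u = h" and v: "v \<in> lists I" "word_prod G v = k"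
    by blast
  moreover have "set u \<subseteq> carrier G" "set v \<subseteq> carrier G"
    using u v assms(1) generators_closed by auto
  ultimately show ?case
    by (intro bexI[of _ "u @ v"]) (auto simp: word_prod_append)
qed

lemma cox_length_le: "u \<in> lists S \<Longrightarrow> cox_length G S (word_prod G u) \<le> length u"
  unfolding cox_length_def by (rule Least_le) blast

lemma ex_reduced_word:
  assumes "w \<in> carrier G"
  shows "\<exists>u \<in> lists S. length u = cox_length G S w \<and> word_prod G u = w"
proof -
  have "\<exists>n. \<exists>u \<in> lists S. length u = n \<and> word_prod G u = w"
    using ex_word[of S w] assms generate_generators by auto
  then show ?thesis unfolding cox_length_def by (rule LeastI_ex)
qed

text \<open>
  A reflection that occurs exactly once in the list of $u$ has odd count, hence occurs in the list of
  every word with the same product. If no reflection is repeated in $u$, a reduced word for the same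
  element thus has at least as many reflections, and as many letters, as $u$.
\<close>

theorem deletion:
  assumes u: "u \<in> lists S" and l: "cox_length G S (word_prod G u) < length u"
  shows "\<exists>v. subseq v u \<and> length v < length u \<and> word_prod G v = word_prod G u"
proof (rule repeated_reflection_deletes[OF u], rule notI)
  assume d: "distinct (word_reflections G u)"
  have uc: "set u \<subseteq> carrier G" using u lists_carrier by blast
  obtain v where v: "v \<in> lists S" "length v = cox_length G S (word_prod G u)"
      "word_prod G v = word_prod G u"
    using ex_reduced_word[of "word_prod G u"] uc by auto
  have "set (word_reflections G u) \<subseteq> set (word_reflections G v)"
  proof
    fix y assume y: "y \<in> set (word_reflections G u)"
    have "count_list xs y = (if y \<in> set xs then 1 else 0)" if "distinct xs" for xs
      using that by (induction xs) auto
    with y d have "count_list (word_reflections G u) y = 1" by simp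
    moreover have "y \<in> carrier G" using y uc word_reflections_closed by blast
    ultimately have "odd (count_list (word_reflections G v) y)"
      using even_count_word_reflections[OF u v(1) v(3)[symmetric]] by (metis odd_one)
    then show "y \<in> set (word_reflections G v)" using count_notin by fastforce
  qed
  then have "card (set (word_reflections G u)) \<le> card (set (word_reflections G v))"
    by (intro card_mono) auto
  also have "\<dots> \<le> length v" using card_length[of "word_reflections G v"] by simp
  finally show False using d v l by (simp add: distinct_card)
qed

lemma ex_reduced_subword:
  assumes "u \<in> lists S"
  shows "\<exists>v. subseq v u \<and> v \<in> lists S \<and> word_prod G v = word_prod G u \<and>
             length v = cox_length G S (word_prod G u)"
  using assms
proof (induction u rule: length_induct)
  case (1 u)
  show ?case
  proof (cases "cox_length G S (word_prod G u) < length u")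
    case True
    then obtain v where v: "subseq v u" "length v < length u" "word_prod G v = word_prod G u"
      using deletion 1 by blast
    have "v \<in> lists S" using v(1) 1(2) by (auto dest: list_emb_set)
    with 1(1) v show ?thesis using subseq_order.trans by metis
  next
    case False
    then show ?thesis using 1(2) cox_length_le[of u] by (intro exI[of _ u]) auto
  qed
qed

section \<open>Representatives of minimal length in double cosets\<close>

lemma inv_word_prod: "u \<in> lists S \<Longrightarrow> inv (word_prod G u) = word_prod G (rev u)"
  by (induction u)
     (auto simp: word_prod_append lists_carrier inv_mult_group inv_generator generator_mem)

lemma cox_length_inv:
  assumes "w \<in> carrier G"
  shows "cox_length G S (inv w) = cox_length G S w"
proof -
  have le: "cox_length G S (inv w) \<le> cox_length G S w" if w: "w \<in> carrier G" for w
  proof -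
    obtain u where u: "u \<in> lists S" "length u = cox_length G S w" "word_prod G u = w"
      using ex_reduced_word[OF w] by blast
    then show ?thesis using inv_word_prod[of u] cox_length_le[of "rev u"] by (simp add: lists_eq_set)
  qed
  show ?thesis using le[of w] le[of "inv w"] assms by simp
qed

text \<open>
  Relators have even length, so the length of a word modulo 2 is determined by its product. This is
  the sign character; it excludes that $sw$ and $w$ have equal length, which turns the weak
  inequalities of a length-minimal element into the strict ones that define $X_{IJ}$.
\<close>

lemma even_length_coxeter_step: "coxeter_step G S u v \<Longrightarrow> even (length u) = even (length v)"
  by (induction rule: coxeter_step.induct) (simp add: length_concat sum_list_replicate)

lemma even_length_word:
  assumes "u \<in> lists S" "v \<in> lists S" "word_prod G u = word_prod G v"
  shows "even (length u) = even (length v)"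
proof -
  have "equivclp (coxeter_step G S) u v" using assms presentation by blast
  then show ?thesis
    by (induction rule: equivclp_induct) (use even_length_coxeter_step in blast)+
qed

lemma cox_length_mult_generator_neq:
  assumes "s \<in> S" "w \<in> carrier G"
  shows "cox_length G S (s \<otimes> w) \<noteq> cox_length G S w"
proof -
  have "s \<otimes> w \<in> carrier G" using assms generator_mem by blast
  then obtain u v where
      u: "u \<in> lists S" "length u = cox_length G S w" "word_prod G u = w" and
      v: "v \<in> lists S" "length v = cox_length G S (s \<otimes> w)" "word_prod G v = s \<otimes> w"
    using assms ex_reduced_word by meson
  then have "even (length (s # u)) = even (length v)"
    using assms by (intro even_length_word) auto
  then show ?thesis using u v by auto
qed

lemma cox_length_inv_mult:
  assumes "s \<in> S" "w \<in> carrier G"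
  shows "cox_length G S (inv w \<otimes> s) = cox_length G S (s \<otimes> w)"
proof -
  have "inv w \<otimes> s = inv (s \<otimes> w)"
    using assms by (simp add: inv_mult_group generator_mem inv_generator)
  then show ?thesis using assms generator_mem cox_length_inv by simp
qed

lemma X_double_iff:
  assumes "I \<subseteq> S"
  shows "w \<in> X_double G S I J \<longleftrightarrow> w \<in> carrier G \<and>
           (\<forall>s\<in>I. cox_length G S w < cox_length G S (s \<otimes> w)) \<and>
           (\<forall>s\<in>J. cox_length G S w < cox_length G S (w \<otimes> s))"
proof -
  have "w \<in> set_inv (X_set G S I) \<longleftrightarrow> w \<in> carrier G \<and> inv w \<in> X_set G S I"
  proof
    assume "w \<in> set_inv (X_set G S I)"
    then show "w \<in> carrier G \<and> inv w \<in> X_set G S I"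
      by (auto simp: SET_INV_def X_set_def)
  next
    assume "w \<in> carrier G \<and> inv w \<in> X_set G S I"
    then show "w \<in> set_inv (X_set G S I)"
      unfolding SET_INV_def by (auto intro!: bexI[of _ "inv w"])
  qed
  moreover have "cox_length G S (inv w \<otimes> s) = cox_length G S (s \<otimes> w)"
    if "w \<in> carrier G" "s \<in> I" for s
    using that assms cox_length_inv_mult by blast
  ultimately show ?thesis
    by (auto simp: X_double_def X_set_def cox_length_inv)
qed

lemma shortest_mem_X_double:
  assumes I: "I \<subseteq> S" and J: "J \<subseteq> S" and w: "w \<in> carrier G"
    and min: "\<And>a b. a \<in> generate G I \<Longrightarrow> b \<in> generate G J \<Longrightarrow>
                cox_length G S w \<le> cox_length G S (a \<otimes> w \<otimes> b)"
  shows "w \<in> X_double G S I J"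
proof -
  have left: "cox_length G S w < cox_length G S (s \<otimes> w)" if "s \<in> I" for s
  proof -
    have "s \<in> S" "s \<in> carrier G" using that I generator_mem by auto
    then show ?thesis
      using min[OF generate.incl[OF that] generate.one] w cox_length_mult_generator_neq[of s w]
      by simp
  qed
  have right: "cox_length G S w < cox_length G S (w \<otimes> s)" if "s \<in> J" for s
  proof -
    have s: "s \<in> S" "s \<in> carrier G" using that J generator_mem by auto
    have "cox_length G S (w \<otimes> s) = cox_length G S (s \<otimes> inv w)"
      using cox_length_inv_mult[of s "inv w"] s w by simp
    then have "cox_length G S (w \<otimes> s) \<noteq> cox_length G S w"
      using cox_length_mult_generator_neq[of s "inv w"] s w by (simp add: cox_length_inv)
    then show ?thesis
      using min[OF generate.one generate.incl[OF that]] w s by simp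
  qed
  show ?thesis using X_double_iff[OF I] w left right by blast
qed

text \<open>
  A reduced subword of the concatenation of words for $a$, $w$, $b$ splits into a part over $I$, a
  subword of the reduced word for $w$, and a part over $J$. The ascent conditions on $a w b$ force the
  outer parts to be empty, and minimality of $w$ forces the middle part to be the whole word.
\<close>

lemma X_double_eq_shortest:
  assumes I: "I \<subseteq> S" and J: "J \<subseteq> S" and w: "w \<in> carrier G"
    and min: "\<And>a b. a \<in> generate G I \<Longrightarrow> b \<in> generate G J \<Longrightarrow>
                cox_length G S w \<le> cox_length G S (a \<otimes> w \<otimes> b)"
    and a: "a \<in> generate G I" and b: "b \<in> generate G J"
    and x: "a \<otimes> w \<otimes> b \<in> X_double G S I J"
  shows "a \<otimes> w \<otimes> b = w"
proof -
  obtain ua where ua: "ua \<in> lists I" "word_prod G ua = a" using ex_word[OF I a] by blast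
  obtain ub where ub: "ub \<in> lists J" "word_prod G ub = b" using ex_word[OF J b] by blast
  obtain uw where uw: "uw \<in> lists S" "length uw = cox_length G S w" "word_prod G uw = w"
    using ex_reduced_word[OF w] by blast
  have S: "ua \<in> lists S" "ub \<in> lists S" using ua ub I J by auto
  have c: "set ua \<subseteq> carrier G" "set uw \<subseteq> carrier G" "set ub \<subseteq> carrier G"
    using S uw lists_carrier by blast+
  have cab: "a \<in> carrier G" "b \<in> carrier G" using ua ub c word_prod_closed by blast+
  have prod: "word_prod G (ua @ uw @ ub) = a \<otimes> w \<otimes> b"
    using c ua ub uw w cab by (simp add: word_prod_append m_assoc)
  obtain v where v: "subseq v (ua @ uw @ ub)" "v \<in> lists S"
      "word_prod G v = a \<otimes> w \<otimes> b" "length v = cox_length G S (a \<otimes> w \<otimes> b)"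
    using ex_reduced_subword[of "ua @ uw @ ub"] S uw prod by auto
  from v(1) obtain va vw vb where
      vs: "v = va @ vw @ vb" "subseq va ua" "subseq vw uw" "subseq vb ub"
    by (auto elim!: subseq_appendE)
  have vI: "va \<in> lists I" and vJ: "vb \<in> lists J"
    using vs ua ub by (auto dest: list_emb_set)
  have vS: "vw \<in> lists S" "va \<in> lists S" "vb \<in> lists S" using v vs by auto
  have vc: "set va \<subseteq> carrier G" "set vw \<subseteq> carrier G" "set vb \<subseteq> carrier G"
    using vS lists_carrier by blast+
  have "va = []"
  proof (cases va)
    case (Cons s u)
    then have s: "s \<in> I" "s \<in> S" "s \<in> carrier G" using vI I generator_mem by auto
    have "s \<otimes> (a \<otimes> w \<otimes> b) = word_prod G (u @ vw @ vb)"
      using s Cons vc by (simp add: v(3)[symmetric] vs(1) generator_cancel)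
    then have "cox_length G S (s \<otimes> (a \<otimes> w \<otimes> b)) < length v"
      using cox_length_le[of "u @ vw @ vb"] Cons vS vs by auto
    then show ?thesis using X_double_iff[OF I] x s v(4) by fastforce
  qed
  moreover have "vb = []"
  proof (cases vb rule: rev_cases)
    case (snoc u s)
    then have s: "s \<in> J" "s \<in> S" "s \<in> carrier G" using vJ J generator_mem by auto
    have "(a \<otimes> w \<otimes> b) \<otimes> s = word_prod G (va @ vw @ u)"
      using s snoc vc
      by (simp add: v(3)[symmetric] vs(1) word_prod_append m_assoc generator_sq)
    then have "cox_length G S ((a \<otimes> w \<otimes> b) \<otimes> s) < length v"
      using cox_length_le[of "va @ vw @ u"] snoc vS vs by auto
    then show ?thesis using X_double_iff[OF I] x s v(4) by fastforce
  qed
  ultimately have eq: "v = vw" using vs by simp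
  have "length uw \<le> length vw"
    using min[OF a b] uw v eq by simp
  then have "vw = uw"
    using vs(3) by (meson le_antisym list_emb_length subseq_same_length)
  then show ?thesis using eq uw v by simp
qed

theorem ex1_X_double:
  assumes I: "I \<subseteq> S" and J: "J \<subseteq> S" and z: "z \<in> carrier G"
  shows "\<exists>!x. x \<in> X_double G S I J \<and> (\<exists>a\<in>generate G I. \<exists>b\<in>generate G J. z = a \<otimes> x \<otimes> b)"
proof -
  let ?H = "generate G I" and ?K = "generate G J"
  have H: "subgroup ?H G" and K: "subgroup ?K G"
    using I J generators_closed by (auto intro!: generate_is_subgroup)
  note HK = subgroup.mem_carrier[OF H] subgroup.mem_carrier[OF K]
  define D where "D = {w \<in> carrier G. \<exists>a\<in>?H. \<exists>b\<in>?K. z = a \<otimes> w \<otimes> b}"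
  have "z \<in> D"
    using z generate.one[of G] by (auto simp: D_def intro!: bexI[of _ \<one>])
  then obtain w where "w \<in> D" and least: "\<And>y. y \<in> D \<Longrightarrow> cox_length G S w \<le> cox_length G S y"
    using ex_has_least_nat[of "\<lambda>w. w \<in> D" z "cox_length G S"] by blast
  then obtain a b where w: "w \<in> carrier G" and a: "a \<in> ?H" and b: "b \<in> ?K"
      and zw: "z = a \<otimes> w \<otimes> b"
    by (auto simp: D_def)
  have min: "cox_length G S w \<le> cox_length G S (c \<otimes> w \<otimes> d)" if "c \<in> ?H" "d \<in> ?K" for c d
  proof (rule least)
    have "z = (a \<otimes> inv c) \<otimes> (c \<otimes> w \<otimes> d) \<otimes> (inv d \<otimes> b)"
      using that a b w HK by (simp add: zw m_assoc inv_cancel_left cancel_inv_left)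
    moreover have "a \<otimes> inv c \<in> ?H" "inv d \<otimes> b \<in> ?K"
      using that a b H K by (auto simp: subgroup.m_closed subgroup.m_inv_closed)
    ultimately show "c \<otimes> w \<otimes> d \<in> D"
      using that w HK unfolding D_def by blast
  qed
  show ?thesis
  proof (rule ex1I[of _ w])
    show "w \<in> X_double G S I J \<and> (\<exists>a\<in>?H. \<exists>b\<in>?K. z = a \<otimes> w \<otimes> b)"
      using shortest_mem_X_double[OF I J w min] a b zw by blast
  next
    fix x assume "x \<in> X_double G S I J \<and> (\<exists>a\<in>?H. \<exists>b\<in>?K. z = a \<otimes> x \<otimes> b)"
    then obtain c d where x: "x \<in> X_double G S I J" and c: "c \<in> ?H" and d: "d \<in> ?K"
        and zx: "z = c \<otimes> x \<otimes> d" by blast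
    have xc: "x \<in> carrier G" using x X_double_iff[OF I] by blast
    have "inv c \<otimes> z \<otimes> inv d = x"
      using c d xc HK by (simp add: zx m_assoc inv_cancel_left)
    moreover have "inv c \<otimes> z \<otimes> inv d = (inv c \<otimes> a) \<otimes> w \<otimes> (b \<otimes> inv d)"
      using a b c d w HK by (simp add: zw m_assoc)
    ultimately have "x = (inv c \<otimes> a) \<otimes> w \<otimes> (b \<otimes> inv d)" by simp
    moreover have "inv c \<otimes> a \<in> ?H" "b \<otimes> inv d \<in> ?K"
      using a b c d H K by (auto simp: subgroup.m_closed subgroup.m_inv_closed)
    ultimately show "x = w"
      using X_double_eq_shortest[OF I J w min] x by metis
  qed
qed

end

section \<open>Inner products of permutation characters\<close>

context group
begin

lemma induced_trivial_char:
  assumes "finite (carrier G)"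
  shows "induced_char G H trivial_char g =
           of_nat (card {x \<in> carrier G. inv x \<otimes> g \<otimes> x \<in> H}) / of_nat (card H)"
  using assms by (simp add: induced_char_def trivial_char_def sum.If_cases Int_def)

text \<open>
  The triple $(w, x, y)$ corresponds to $(x, x^{-1} y, x^{-1} w x)$: conjugating by $x$ moves the
  condition on $x$ to a standard position, so that $x$ itself becomes free.
\<close>

lemma card_double_conjugates:
  assumes fin: "finite (carrier G)" and H: "subgroup H G" and K: "subgroup K G"
  shows "(\<Sum>w\<in>carrier G. card {x \<in> carrier G. inv x \<otimes> w \<otimes> x \<in> H} *
                          card {y \<in> carrier G. inv y \<otimes> w \<otimes> y \<in> K}) =
         card (carrier G) * card (SIGMA z:carrier G. {h \<in> H. inv z \<otimes> h \<otimes> z \<in> K})"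
proof -
  let ?A = "SIGMA w:carrier G. {x \<in> carrier G. inv x \<otimes> w \<otimes> x \<in> H} \<times>
                               {y \<in> carrier G. inv y \<otimes> w \<otimes> y \<in> K}"
  let ?B = "carrier G \<times> (SIGMA z:carrier G. {h \<in> H. inv z \<otimes> h \<otimes> z \<in> K})"
  note HK = subgroup.mem_carrier[OF H] subgroup.mem_carrier[OF K]
  have "bij_betw (\<lambda>(w, x, y). (x, inv x \<otimes> y, inv x \<otimes> w \<otimes> x)) ?A ?B"
    by (rule bij_betw_byWitness[where f' = "\<lambda>(x, z, h). (x \<otimes> h \<otimes> inv x, x, x \<otimes> z)"])
       (auto simp: m_assoc inv_mult_group inv_cancel_left cancel_inv_left HK)
  then have "card ?A = card ?B" by (rule bij_betw_same_card)
  then show ?thesis using fin by (simp add: card_cartesian_product)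
qed

text \<open>
  The $h \in H$ with $z^{-1} h z \in K$ act freely and transitively on the decompositions
  $z = a x b$, by $(a, b) \mapsto (h a, b z^{-1} h^{-1} z)$. Once a decomposition $a_0 x_0 b_0$ is chosen
  for each $z$, the others correspond to the elements $h$; the bijection sends $(x, a, b)$ to
  $z = a x b$ and $h = a a_0^{-1}$.
\<close>

lemma card_double_coset_stabilizers:
  assumes H: "subgroup H G" and K: "subgroup K G" and X: "X \<subseteq> carrier G"
    and reps: "\<And>z. z \<in> carrier G \<Longrightarrow> \<exists>!x. x \<in> X \<and> (\<exists>a\<in>H. \<exists>b\<in>K. z = a \<otimes> x \<otimes> b)"
  shows "card (SIGMA z:carrier G. {h \<in> H. inv z \<otimes> h \<otimes> z \<in> K}) = card X * card H * card K"
proof -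
  let ?C = "SIGMA z:carrier G. {h \<in> H. inv z \<otimes> h \<otimes> z \<in> K}"
  note HK = subgroup.mem_carrier[OF H] subgroup.mem_carrier[OF K] subsetD[OF X]
  note cl = subgroup.m_closed[OF H] subgroup.m_closed[OF K]
    subgroup.m_inv_closed[OF H] subgroup.m_inv_closed[OF K]
  note grp = m_assoc inv_mult_group inv_cancel_left cancel_inv_left
  have "\<forall>z\<in>carrier G. \<exists>x a b. x \<in> X \<and> a \<in> H \<and> b \<in> K \<and> z = a \<otimes> x \<otimes> b"
    using reps by blast
  then obtain x0 a0 b0 where dec: "\<And>z. z \<in> carrier G \<Longrightarrow>
      x0 z \<in> X \<and> a0 z \<in> H \<and> b0 z \<in> K \<and> z = a0 z \<otimes> x0 z \<otimes> b0 z"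
    by metis
  have x0: "x0 (a \<otimes> x \<otimes> b) = x" if "x \<in> X" "a \<in> H" "b \<in> K" for x a b
    using reps[of "a \<otimes> x \<otimes> b"] dec[of "a \<otimes> x \<otimes> b"] that HK by blast
  let ?f = "\<lambda>(x, a, b). (a \<otimes> x \<otimes> b, a \<otimes> inv (a0 (a \<otimes> x \<otimes> b)))"
  let ?g = "\<lambda>(z, h). (x0 z, h \<otimes> a0 z, b0 z \<otimes> (inv z \<otimes> inv h \<otimes> z))"
  have fwd: "?f (x, a, b) \<in> ?C \<and> ?g (?f (x, a, b)) = (x, a, b)"
    if mem: "x \<in> X" "a \<in> H" "b \<in> K" for x a b
  proof -
    define z where "z = a \<otimes> x \<otimes> b"
    have z: "z \<in> carrier G" using mem HK by (simp add: z_def)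
    have d: "a0 z \<in> H" "b0 z \<in> K" "z = a0 z \<otimes> x \<otimes> b0 z"
      using dec[OF z] x0[OF mem] by (auto simp: z_def)
    have c: "a \<in> carrier G" "b \<in> carrier G" "x \<in> carrier G"
        "a0 z \<in> carrier G" "b0 z \<in> carrier G"
      using mem d HK by auto
    have "inv a \<otimes> z = x \<otimes> b"
      using c by (simp add: z_def grp)
    moreover have "inv (a0 z) \<otimes> z = x \<otimes> b0 z"
      using c by (subst (2) d(3)) (simp add: grp)
    moreover have "inv z \<otimes> a = inv (inv a \<otimes> z)" "inv z \<otimes> a0 z = inv (inv (a0 z) \<otimes> z)"
      using c z by (simp_all add: inv_mult_group)
    ultimately have e: "inv a \<otimes> z = x \<otimes> b" "inv (a0 z) \<otimes> z = x \<otimes> b0 z"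
        "inv z \<otimes> a = inv (x \<otimes> b)" "inv z \<otimes> a0 z = inv (x \<otimes> b0 z)"
      by simp_all
    have "inv z \<otimes> (a \<otimes> inv (a0 z)) \<otimes> z = (inv z \<otimes> a) \<otimes> (inv (a0 z) \<otimes> z)"
      using c z by (simp add: m_assoc)
    also have "\<dots> = inv b \<otimes> b0 z"
      unfolding e using c by (simp add: grp)
    finally have k: "inv z \<otimes> (a \<otimes> inv (a0 z)) \<otimes> z = inv b \<otimes> b0 z" .
    have "inv z \<otimes> inv (a \<otimes> inv (a0 z)) \<otimes> z = inv (inv z \<otimes> (a \<otimes> inv (a0 z)) \<otimes> z)"
      using c z by (simp add: inv_mult_group m_assoc)
    then have "b0 z \<otimes> (inv z \<otimes> inv (a \<otimes> inv (a0 z)) \<otimes> z) = b"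
      unfolding k using c by (simp add: grp)
    moreover have "a \<otimes> inv (a0 z) \<otimes> a0 z = a" using c by (simp add: m_assoc)
    ultimately show ?thesis
      using mem d k z cl x0[OF mem] by (simp flip: z_def)
  qed
  have bwd: "?g (z, h) \<in> X \<times> H \<times> K \<and> ?f (?g (z, h)) = (z, h)"
    if mem: "z \<in> carrier G" "h \<in> H" "inv z \<otimes> h \<otimes> z \<in> K" for z h
  proof -
    have d: "x0 z \<in> X" "a0 z \<in> H" "b0 z \<in> K" "a0 z \<otimes> x0 z \<otimes> b0 z = z"
      using dec[OF mem(1)] by auto
    have c: "h \<in> carrier G" "x0 z \<in> carrier G" "a0 z \<in> carrier G" "b0 z \<in> carrier G"
      using mem d HK by auto
    have "inv z \<otimes> inv h \<otimes> z = inv (inv z \<otimes> h \<otimes> z)"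
      using c mem(1) by (simp add: inv_mult_group m_assoc)
    then have k: "inv z \<otimes> inv h \<otimes> z \<in> K" using mem(3) cl by simp
    have "(h \<otimes> a0 z) \<otimes> x0 z \<otimes> (b0 z \<otimes> (inv z \<otimes> inv h \<otimes> z)) =
          h \<otimes> (a0 z \<otimes> x0 z \<otimes> b0 z) \<otimes> (inv z \<otimes> inv h \<otimes> z)"
      using c mem(1) by (simp add: m_assoc)
    also have "\<dots> = z" unfolding d(4) using c mem(1) by (simp add: grp)
    finally show ?thesis
      using mem d k c cl by (simp add: m_assoc)
  qed
  define f where "f = ?f"
  define g where "g = ?g"
  have f: "f p \<in> ?C \<and> g (f p) = p" if "p \<in> X \<times> H \<times> K" for p
  proof -
    obtain x a b where p: "p = (x, a, b)" by (cases p)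
    then have "x \<in> X" "a \<in> H" "b \<in> K" using that by simp_all
    then show ?thesis unfolding p f_def g_def by (rule fwd)
  qed
  have g: "g q \<in> X \<times> H \<times> K \<and> f (g q) = q" if "q \<in> ?C" for q
  proof -
    obtain z h where q: "q = (z, h)" by (cases q)
    then have "z \<in> carrier G" "h \<in> H" "inv z \<otimes> h \<otimes> z \<in> K" using that by simp_all
    then show ?thesis unfolding q f_def g_def by (rule bwd)
  qed
  have "bij_betw f (X \<times> H \<times> K) ?C"
    by (rule bij_betw_byWitness[where f' = g]) (use f g in blast)+
  then have "card (X \<times> H \<times> K) = card ?C" by (rule bij_betw_same_card)
  then show ?thesis by (simp add: card_cartesian_product)
qed

theorem char_inner_permutation_chars:
  assumes fin: "finite (carrier G)" and H: "subgroup H G" and K: "subgroup K G"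
    and X: "X \<subseteq> carrier G"
    and reps: "\<And>z. z \<in> carrier G \<Longrightarrow> \<exists>!x. x \<in> X \<and> (\<exists>a\<in>H. \<exists>b\<in>K. z = a \<otimes> x \<otimes> b)"
  shows "char_inner G (induced_char G H trivial_char) (induced_char G K trivial_char) =
           of_nat (card X)"
proof -
  have pos: "card (carrier G) \<noteq> 0" "card H \<noteq> 0" "card K \<noteq> 0"
  proof -
    have "card A \<noteq> 0" if "subgroup A G" for A
      using subgroup.subset[OF that] subgroup.one_closed[OF that] fin
      by (auto simp: card_eq_0_iff dest: finite_subset)
    then show "card (carrier G) \<noteq> 0" "card H \<noteq> 0" "card K \<noteq> 0"
      using H K subgroup_self by blast+
  qed
  have stab: "card (SIGMA z:carrier G. {h \<in> H. inv z \<otimes> h \<otimes> z \<in> K}) = card X * card H * card K"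
    using card_double_coset_stabilizers[OF H K X] reps by blast
  have "(\<Sum>w\<in>carrier G. induced_char G H trivial_char w * induced_char G K trivial_char w) =
        of_nat (\<Sum>w\<in>carrier G. card {x \<in> carrier G. inv x \<otimes> w \<otimes> x \<in> H} *
                                card {y \<in> carrier G. inv y \<otimes> w \<otimes> y \<in> K}) /
        (of_nat (card H) * of_nat (card K))"
    by (simp add: induced_trivial_char[OF fin] sum_divide_distrib)
  also have "\<dots> = of_nat (card (carrier G)) * of_nat (card X)"
    unfolding card_double_conjugates[OF fin H K] stab
    using pos by simp
  finally show ?thesis using pos by (simp add: char_inner_def)
qed

end

theorem corollary3p2:
  fixes W :: "('a, 'b) monoid_scheme" and S I J :: "'a set"
  assumes "coxeter_system W S" and "finite (carrier W)"
    and "I \<subseteq> S" and "J \<subseteq> S"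
  shows "of_nat (card (X_double W S I J)) =
           char_inner W (induced_char W (generate W I) trivial_char)
                        (induced_char W (generate W J) trivial_char)
       \<and> of_nat (card {w \<in> carrier W. I \<subseteq> ascent_set W S w \<and> J \<subseteq> ascent_set W S (inv\<^bsub>W\<^esub> w)}) =
           char_inner W (induced_char W (generate W I) trivial_char)
                        (induced_char W (generate W J) trivial_char)"
proof -
  interpret coxeter_system W S by fact
  have main: "of_nat (card (X_double W S A B)) =
      char_inner W (induced_char W (generate W A) trivial_char)
                   (induced_char W (generate W B) trivial_char)"
    if AB: "A \<subseteq> S" "B \<subseteq> S" for A B
  proof (rule char_inner_permutation_chars[symmetric])
    show "subgroup (generate W A) W" "subgroup (generate W B) W"
      using AB generators_closed by (auto intro!: generate_is_subgroup)
    show "X_double W S A B \<subseteq> carrier W" using X_double_iff[OF AB(1)] by blast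
  qed (use assms(2) ex1_X_double[OF AB] in auto)
  (* Here I governs multiplication of w from the right and J multiplication from the left, the
     opposite of the convention for X_IJ; the inner product is symmetric. *)
  have "{w \<in> carrier W. I \<subseteq> ascent_set W S w \<and> J \<subseteq> ascent_set W S (inv\<^bsub>W\<^esub> w)} =
        X_double W S J I"
  proof (rule Set.set_eqI)
    fix w
    have "w \<in> carrier W \<Longrightarrow> s \<in> J \<Longrightarrow>
        cox_length W S (inv\<^bsub>W\<^esub> w \<otimes>\<^bsub>W\<^esub> s) = cox_length W S (s \<otimes>\<^bsub>W\<^esub> w)" for s
      using assms(4) cox_length_inv_mult by blast
    then show "w \<in> {w \<in> carrier W. I \<subseteq> ascent_set W S w \<and>
          J \<subseteq> ascent_set W S (inv\<^bsub>W\<^esub> w)} \<longleftrightarrow> w \<in> X_double W S J I"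
      unfolding X_double_iff[OF assms(4)] ascent_set_def
      using assms(3,4) by (auto simp: cox_length_inv)
  qed
  moreover have "char_inner W f g = char_inner W g f" for f g
    by (simp add: char_inner_def mult.commute)
  ultimately show ?thesis using main assms(3,4) by metis
qed

end
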